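(* Let $a>0$, $b\in\mathbb{R}\setminus\{0,-a\}$, $\mu>0$ and $I_1,I_2,I_3>0$. The reduced system of a rubber ball of (signed) radius $b$ rolling over a ball of radius $a$ is conformally symplectic: on $T^*S^2$, $$d\Big[f_{a,b}(\gamma)\big(\omega_{can}^{T^*S^2}+(J,K)\big)\Big]=0,\qquad f_{a,b}(\gamma)=F(\gamma)^{\frac{b-a}{2a}},$$ where $$F(\gamma)=I_1I_2I_3\Big(1+\frac ba\Big)^2\left((A^{-1}\gamma,\gamma)+\mu b^2\Big[\frac{\gamma_2^2+\gamma_3^2}{I_2I_3}+\frac{\gamma_1^2+\gamma_3^2}{I_1I_3}+\frac{\gamma_1^2+\gamma_2^2}{I_1I_2}\Big]+\frac{\mu^2b^4}{I_1I_2I_3}\right).$$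
   Context: Here $S^2\subset\mathbb{R}^3$ is the unit sphere with points $\gamma$, $A=\mathrm{diag}(I_1,I_2,I_3)$ is the inertia matrix of the rolling ball (center of mass at the geometric center), $\mu$ its mass; $b<0$ represents rolling where one sphere contains the other. $\omega_{can}^{T^*S^2}=dp_\gamma\wedge d\gamma$ is the canonical 2-form (sign convention $\sum dp_i\wedge dq_i$). Rubber rolling (no slip, no twist) is a nonholonomic system on $S_a\times SO(3)$ with $SO(3)$-symmetry; its reduction to $T^*S^2$ uses the compressed Lagrangian $$T_{red}(\gamma,\dot\gamma)=\tfrac12\Big(1+\frac ba\Big)^2\big[\mu b^2|\dot\gamma|^2+(A(\gamma\times\dot\gamma),\gamma\times\dot\gamma)\big],$$ whose Legendre transform is $p_\gamma=G(\gamma)\dot\gamma=(1+\frac ba)^2[\mu b^2\dot\gamma+A(\gamma\times\dot\gamma)\times\gamma]$ (identifying $T_\gamma^*S^2$ with $T_\gamma S^2=\gamma^\perp$ by the Euclidean inner product), and the 2-form $\omega_{nh}=\omega_{can}^{T^*S^2}+(J,K)$, where $(J,K)$ is the semi-basic 2-form (pairing of the momentum map $J$ of the $SO(3)$ action with the curvature $K$ of the constraint connection) $$(J,K)=\Big(1-\frac ba\Big)\Big(1+\frac ba\Big)^2\,\big(\gamma,A(\dot\gamma\times\gamma)\big)\,dS^2,\qquad \dot\gamma=G(\gamma)^{-1}p_\gamma,$$ with $dS^2$ the pullback to $T^*S^2$ of the area form $dS^2_\gamma(u,v)=(\gamma,u\times v)$ of the unit sphere. *)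

theory Defs
  imports "HOL-Analysis.Analysis"
begin

subsection \<open>Differential forms on embedded 4-manifolds\<close>

text \<open>A differential form on an embedded submanifold \<open>M\<close> is a function of a base point and
  tangent vectors; only its values at points of \<open>M\<close> on vectors tangent to \<open>M\<close> matter.\<close>

type_synonym 'a form2 = "'a \<Rightarrow> 'a \<Rightarrow> 'a \<Rightarrow> real"
type_synonym 'a form3 = "'a \<Rightarrow> 'a \<Rightarrow> 'a \<Rightarrow> 'a \<Rightarrow> real"

primrec Ck_on ::
  "nat \<Rightarrow> 'a::euclidean_space set \<Rightarrow> ('a \<Rightarrow> 'b::euclidean_space) \<Rightarrow> bool" where
  "Ck_on 0 U f = continuous_on U f"
| "Ck_on (Suc k) U f =
    ((\<forall>x\<in>U. f differentiable (at x)) \<and> (\<forall>v. Ck_on k U (\<lambda>x. frechet_derivative f (at x) v)))"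

definition smooth_on :: "'a::euclidean_space set \<Rightarrow> ('a \<Rightarrow> 'b::euclidean_space) \<Rightarrow> bool" where
  "smooth_on U f \<longleftrightarrow> (\<forall>k. Ck_on k U f)"

definition local_param :: "'a::euclidean_space set \<Rightarrow> (real^4) set \<Rightarrow> (real^4 \<Rightarrow> 'a) \<Rightarrow> bool" where
  "local_param M U \<phi> \<longleftrightarrow>
     open U \<and> smooth_on U \<phi> \<and>
     (\<forall>z\<in>U. inj (frechet_derivative \<phi> (at z))) \<and>
     \<phi> ` U \<subseteq> M \<and> openin (top_of_set M) (\<phi> ` U) \<and>
     (\<exists>\<psi>. homeomorphism U (\<phi> ` U) \<phi> \<psi>)"

definition pullback2 ::
  "('e::euclidean_space \<Rightarrow> 'a::euclidean_space) \<Rightarrow> 'a form2 \<Rightarrow> 'e form2" where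
  "pullback2 \<phi> \<omega> z u v =
     \<omega> (\<phi> z) (frechet_derivative \<phi> (at z) u) (frechet_derivative \<phi> (at z) v)"

definition pullback3 ::
  "('e::euclidean_space \<Rightarrow> 'a::euclidean_space) \<Rightarrow> 'a form3 \<Rightarrow> 'e form3" where
  "pullback3 \<phi> \<eta> z u v w =
     \<eta> (\<phi> z) (frechet_derivative \<phi> (at z) u) (frechet_derivative \<phi> (at z) v)
       (frechet_derivative \<phi> (at z) w)"

text \<open>Exterior derivative of a 2-form on an open subset of a Euclidean space, normalised so that
  \<open>d (g dx \<and> dy) = dg \<and> dx \<and> dy\<close> and \<open>(dx \<and> dy) (u, v) = dx u * dy v - dx v * dy u\<close>.\<close>

definition ext_deriv2 :: "'e::euclidean_space form2 \<Rightarrow> 'e form3" where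
  "ext_deriv2 \<omega> z u v w =
     frechet_derivative (\<lambda>y. \<omega> y v w) (at z) u
   - frechet_derivative (\<lambda>y. \<omega> y u w) (at z) v
   + frechet_derivative (\<lambda>y. \<omega> y u v) (at z) w"

text \<open>\<open>d \<omega> = \<eta>\<close> on the embedded 4-manifold \<open>M\<close>: \<open>\<omega>\<close> has differentiable coefficients in all local
  parametrisations, and there \<open>d\<close> is given by the formula above.\<close>

definition has_exterior_derivative_on ::
  "'a::euclidean_space form2 \<Rightarrow> 'a form3 \<Rightarrow> 'a set \<Rightarrow> bool" where
  "has_exterior_derivative_on \<omega> \<eta> M \<longleftrightarrow>
     (\<forall>U \<phi>. local_param M U \<phi> \<longrightarrow> (\<forall>z\<in>U.
        (\<forall>u v. (\<lambda>y. pullback2 \<phi> \<omega> y u v) differentiable (at z)) \<and>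
        (\<forall>u v w. ext_deriv2 (pullback2 \<phi> \<omega>) z u v w = pullback3 \<phi> \<eta> z u v w)))"

definition tangent_vectors :: "'a::euclidean_space set \<Rightarrow> 'a \<Rightarrow> 'a set" where
  "tangent_vectors M x =
     {X. \<exists>c. c 0 = x \<and> (\<forall>t::real. c t \<in> M) \<and> (c has_vector_derivative X) (at 0)}"

definition nondegenerate_on :: "'a::euclidean_space form2 \<Rightarrow> 'a set \<Rightarrow> bool" where
  "nondegenerate_on \<omega> M \<longleftrightarrow>
     (\<forall>x\<in>M. \<forall>X\<in>tangent_vectors M x. (\<forall>Y\<in>tangent_vectors M x. \<omega> x X Y = 0) \<longrightarrow> X = 0)"

definition conformally_symplectic_with ::
  "'a::euclidean_space set \<Rightarrow> 'a form2 \<Rightarrow> ('a \<Rightarrow> real) \<Rightarrow> bool" where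
  "conformally_symplectic_with M \<omega> f \<longleftrightarrow>
     nondegenerate_on \<omega> M \<and> (\<forall>x\<in>M. f x > 0) \<and>
     has_exterior_derivative_on (\<lambda>x X Y. f x * \<omega> x X Y) (\<lambda>_ _ _ _. 0) M"


subsection \<open>The cotangent bundle of the unit sphere\<close>

text \<open>\<open>T\<^sup>*S\<^sup>2\<close> consists of the pairs \<open>(\<gamma>, p)\<close>, cotangent vectors being identified with elements of
  the orthogonal complement of \<open>\<gamma>\<close> by the Euclidean inner product. Tangent vectors of \<open>T\<^sup>*S\<^sup>2\<close> are
  pairs (component along \<open>\<gamma>\<close>, component along \<open>p\<close>).\<close>

definition sphere_tangent :: "real^3 \<Rightarrow> (real^3) set" where
  "sphere_tangent \<gamma> = {v. \<gamma> \<bullet> v = 0}"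

definition cotangent_S2 :: "((real^3) \<times> (real^3)) set" where
  "cotangent_S2 = {(\<gamma>, p). norm \<gamma> = 1 \<and> p \<in> sphere_tangent \<gamma>}"

text \<open>The canonical form with the sign convention \<open>\<Sum>i. dp\<^sub>i \<and> d\<gamma>\<^sub>i\<close>.\<close>

definition omega_can :: "((real^3) \<times> (real^3)) form2" where
  "omega_can x X Y = snd X \<bullet> fst Y - snd Y \<bullet> fst X"

definition area_S2 :: "(real^3) form2" where
  "area_S2 \<gamma> u v = \<gamma> \<bullet> cross3 u v"


subsection \<open>Rubber rolling\<close>

definition inertia :: "real \<Rightarrow> real \<Rightarrow> real \<Rightarrow> real^3^3" where
  "inertia I1 I2 I3 = vector [vector [I1, 0, 0], vector [0, I2, 0], vector [0, 0, I3]]"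

definition T_red :: "real \<Rightarrow> real \<Rightarrow> real \<Rightarrow> real^3^3 \<Rightarrow> real^3 \<Rightarrow> real^3 \<Rightarrow> real" where
  "T_red a b \<mu> A \<gamma> v =
     1/2 * (1 + b/a)^2 * (\<mu> * b^2 * (norm v)^2 + (A *v cross3 \<gamma> v) \<bullet> cross3 \<gamma> v)"

text \<open>The Legendre transform \<open>G(\<gamma>)\<close> of \<open>T_red\<close>, a map of \<open>T\<^sub>\<gamma>S\<^sup>2\<close> to itself.\<close>

definition legendre :: "real \<Rightarrow> real \<Rightarrow> real \<Rightarrow> real^3^3 \<Rightarrow> real^3 \<Rightarrow> real^3 \<Rightarrow> real^3" where
  "legendre a b \<mu> A \<gamma> v =
     (1 + b/a)^2 *\<^sub>R ((\<mu> * b^2) *\<^sub>R v + cross3 (A *v cross3 \<gamma> v) \<gamma>)"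

lemma inertia_mult:
  "inertia I1 I2 I3 *v x = vector [I1 * x$1, I2 * x$2, I3 * x$3]"
  by (simp add: vec_eq_iff inertia_def matrix_vector_mult_def sum_3 forall_3)

lemma legendre_is_fibre_derivative:
  "(T_red a b \<mu> (inertia I1 I2 I3) \<gamma> has_derivative
      (\<lambda>w. legendre a b \<mu> (inertia I1 I2 I3) \<gamma> v \<bullet> w)) (at v)"
proof -
  let ?A = "inertia I1 I2 I3"
  have A: "bounded_linear (\<lambda>x. ?A *v x)" and C: "bounded_linear (cross3 \<gamma>)"
    by (auto simp: linear_conv_bounded_linear[symmetric] linear_iff cross_add_right cross_mult_right
        matrix_vector_right_distrib matrix_vector_mult_scaleR)
  note [derivative_intros] = bounded_linear.has_derivative[OF A] bounded_linear.has_derivative[OF C]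
  have eq: "T_red a b \<mu> ?A \<gamma> =
     (\<lambda>v. 1/2 * (1 + b/a)^2 * (\<mu> * b^2 * (v \<bullet> v) + (?A *v cross3 \<gamma> v) \<bullet> cross3 \<gamma> v))"
    by (simp add: fun_eq_iff T_red_def power2_norm_eq_inner)
  show ?thesis unfolding eq
    apply (rule has_derivative_eq_rhs)
     apply (rule derivative_intros has_derivative_ident)+
    apply (simp add: fun_eq_iff legendre_def inertia_mult cross3_def inner_vec_def sum_3)
    apply (simp add: algebra_simps)
    done
qed

lemma legendre_bij:
  assumes "a > 0" "b \<noteq> 0" "b \<noteq> - a" "\<mu> > 0" "I1 > 0" "I2 > 0" "I3 > 0"
  shows "bij_betw (legendre a b \<mu> (inertia I1 I2 I3) \<gamma>) (sphere_tangent \<gamma>) (sphere_tangent \<gamma>)"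
proof -
  let ?L = "legendre a b \<mu> (inertia I1 I2 I3) \<gamma>"
  have lin: "linear ?L"
    by (simp add: linear_iff legendre_def inertia_mult cross3_def vec_eq_iff forall_3 algebra_simps)
  have c: "(1 + b/a)^2 > 0"
    using assms by (simp add: add_divide_distrib[symmetric] field_simps)
  have pos: "v = 0" if "?L v = 0" for v
  proof -
    have "?L v \<bullet> v = (1 + b/a)^2 * (\<mu> * b^2 * (v \<bullet> v) +
       (I1 * (cross3 \<gamma> v $ 1)^2 + I2 * (cross3 \<gamma> v $ 2)^2 + I3 * (cross3 \<gamma> v $ 3)^2))"
      by (simp add: legendre_def inertia_mult cross3_def inner_vec_def sum_3)
         (simp add: algebra_simps power2_eq_square)
    with that c have "\<mu> * b^2 * (v \<bullet> v) +
       (I1 * (cross3 \<gamma> v $ 1)^2 + I2 * (cross3 \<gamma> v $ 2)^2 + I3 * (cross3 \<gamma> v $ 3)^2) = 0"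
      by simp
    moreover have "I1 * (cross3 \<gamma> v $ 1)^2 + I2 * (cross3 \<gamma> v $ 2)^2 + I3 * (cross3 \<gamma> v $ 3)^2 \<ge> 0"
      using assms by (intro add_nonneg_nonneg mult_nonneg_nonneg) auto
    ultimately have "\<mu> * b^2 * (v \<bullet> v) \<le> 0" by linarith
    moreover have "\<mu> * b^2 > 0" using assms by simp
    ultimately have "v \<bullet> v \<le> 0" by (meson linorder_not_less mult_pos_pos)
    then show ?thesis by (metis inner_eq_zero_iff inner_ge_zero order_antisym)
  qed
  have inj: "inj ?L" using linear_injective_0[OF lin] pos by blast
  have sub: "subspace (sphere_tangent \<gamma>)"
    unfolding sphere_tangent_def by (rule subspace_hyperplane)
  have into: "?L ` sphere_tangent \<gamma> \<subseteq> sphere_tangent \<gamma>"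
    by (auto simp: sphere_tangent_def legendre_def inner_add_right)
       (simp add: cross3_def inner_vec_def sum_3 algebra_simps)
  have "dim (?L ` sphere_tangent \<gamma>) = dim (sphere_tangent \<gamma>)"
    using lin inj by (intro dim_image_eq) (auto intro: inj_on_subset)
  then have "?L ` sphere_tangent \<gamma> = sphere_tangent \<gamma>"
    using sub linear_subspace_image[OF lin sub] into by (intro subspace_dim_equal) auto
  then show ?thesis using inj by (auto simp: bij_betw_def intro: inj_on_subset)
qed

definition legendre_inv :: "real \<Rightarrow> real \<Rightarrow> real \<Rightarrow> real^3^3 \<Rightarrow> real^3 \<Rightarrow> real^3 \<Rightarrow> real^3" where
  "legendre_inv a b \<mu> A \<gamma> = inv_into (sphere_tangent \<gamma>) (legendre a b \<mu> A \<gamma>)"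

text \<open>The pairing \<open>(J, K)\<close> of momentum map and curvature: \<open>area_S2\<close> is pulled back along the bundle
  projection, hence only the \<open>\<gamma>\<close>-components \<open>fst X\<close>, \<open>fst Y\<close> enter.\<close>

definition JK :: "real \<Rightarrow> real \<Rightarrow> real \<Rightarrow> real^3^3 \<Rightarrow> ((real^3) \<times> (real^3)) form2" where
  "JK a b \<mu> A x X Y =
     (let \<gamma> = fst x; v = legendre_inv a b \<mu> A \<gamma> (snd x) in
      (1 - b/a) * (1 + b/a)^2 * (\<gamma> \<bullet> (A *v cross3 v \<gamma>)) * area_S2 \<gamma> (fst X) (fst Y))"

definition omega_nh :: "real \<Rightarrow> real \<Rightarrow> real \<Rightarrow> real^3^3 \<Rightarrow> ((real^3) \<times> (real^3)) form2" where
  "omega_nh a b \<mu> A x X Y = omega_can x X Y + JK a b \<mu> A x X Y"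

definition F_conf ::
  "real \<Rightarrow> real \<Rightarrow> real \<Rightarrow> real \<Rightarrow> real \<Rightarrow> real \<Rightarrow> real^3 \<Rightarrow> real" where
  "F_conf a b \<mu> I1 I2 I3 \<gamma> =
     I1 * I2 * I3 * (1 + b/a)^2 *
       ((matrix_inv (inertia I1 I2 I3) *v \<gamma>) \<bullet> \<gamma>
        + \<mu> * b^2 * (((\<gamma>$2)^2 + (\<gamma>$3)^2) / (I2 * I3)
                    + ((\<gamma>$1)^2 + (\<gamma>$3)^2) / (I1 * I3)
                    + ((\<gamma>$1)^2 + (\<gamma>$2)^2) / (I1 * I2))
        + \<mu>^2 * b^4 / (I1 * I2 * I3))"

definition f_conf ::
  "real \<Rightarrow> real \<Rightarrow> real \<Rightarrow> real \<Rightarrow> real \<Rightarrow> real \<Rightarrow> real^3 \<Rightarrow> real" where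
  "f_conf a b \<mu> I1 I2 I3 \<gamma> = F_conf a b \<mu> I1 I2 I3 \<gamma> powr ((b - a) / (2 * a))"

end

theory Submission
  imports Defs
begin

text \<open>
  On the cotangent bundle of the sphere, a form \<open>f (\<omega>\<^sub>c\<^sub>a\<^sub>n + (p, \<xi>) dS\<^sup>2)\<close> with a function
  \<open>f\<close> and a vector field \<open>\<xi>\<close> on the base is closed as soon as \<open>f \<xi> = \<gamma> \<times> grad f\<close>
  (\<open>gyroscopic_form_closed\<close>): since the base has dimension two, only the terms of \<open>df \<and> \<omega>\<^sub>c\<^sub>a\<^sub>n\<close> and
  \<open>f d(p, \<xi>) \<and> dS\<^sup>2\<close> with one momentum differential survive, and this equation makes them cancel.

  The reduced form of the rubber rolling ball has this shape, because the velocity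
  \<open>G\<^sup>-\<^sup>1 p\<close> enters \<open>(J, K)\<close> linearly. Here \<open>\<xi>\<close> is a multiple of \<open>G\<^sup>-\<^sup>1 (\<gamma> \<times> A \<gamma>)\<close>, and
  the theorem of Cayley and Hamilton shows that \<open>G\<close> maps \<open>\<gamma> \<times> grad F\<close> to a multiple of \<open>F \<gamma> \<times> A \<gamma>\<close>
  (\<open>legendre_half_grad_F\<close>). Thus \<open>\<xi>\<close> is \<open>(b - a) / (2 a)\<close> times \<open>\<gamma> \<times> grad (ln F)\<close>, and a function with
  \<open>\<gamma> \<times> grad (ln f) = \<xi>\<close> is the power of \<open>F\<close> with this exponent.

  The exterior derivative is defined by pulling back along parametrisations. To compute it from
  ambient formulas, \<open>ext_deriv2_pullback2\<close> shows that it commutes with pullbacks; this rests on the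
  symmetry of second derivatives. Nondegeneracy holds for every semi-basic perturbation of the
  canonical form, and \<open>f\<close> is positive because \<open>F\<close> is.
\<close>

section \<open>Symmetry of second derivatives\<close>

text \<open>The mean value theorem applies twice. Along \<open>v\<close>, it is used on the increment of \<open>f\<close> in the
  direction \<open>u\<close>; the result is an increment in the direction \<open>u\<close> of the derivative along \<open>v\<close>, to
  which it applies again. A vector-valued \<open>f\<close> is tested against a fixed vector \<open>e\<close>, because the
  mean value theorem holds only for real functions.\<close>

lemma second_difference_mean_value:
  fixes f :: "'a::real_normed_vector \<Rightarrow> 'b::real_inner"
  assumes f: "\<And>x. x \<in> ball z r \<Longrightarrow> f differentiable (at x)"
    and fv: "\<And>x. x \<in> ball z r \<Longrightarrow> (\<lambda>y. frechet_derivative f (at y) v) differentiable (at x)"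
    and s: "0 < s" "s * (norm u + norm v) < r"
  obtains x where "dist z x \<le> s * (norm u + norm v)"
    and "(f (z + s *\<^sub>R u + s *\<^sub>R v) - f (z + s *\<^sub>R u) - f (z + s *\<^sub>R v) + f z) \<bullet> e
         = s\<^sup>2 * (frechet_derivative (\<lambda>y. frechet_derivative f (at y) v) (at x) u \<bullet> e)"
proof -
  let ?D = "\<lambda>x w. frechet_derivative f (at x) w"
  let ?D2 = "\<lambda>x w. frechet_derivative (\<lambda>y. ?D y v) (at x) w"
  have near: "dist z (z + \<sigma> *\<^sub>R u + \<tau> *\<^sub>R v) \<le> s * (norm u + norm v)"
    if "\<sigma> \<in> {0..s}" "\<tau> \<in> {0..s}" for \<sigma> \<tau>
  proof -
    have "dist z (z + \<sigma> *\<^sub>R u + \<tau> *\<^sub>R v) = norm (\<sigma> *\<^sub>R u + \<tau> *\<^sub>R v)"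
      by (metis add.assoc add_diff_cancel_left' dist_commute dist_norm)
    also have "\<dots> \<le> \<sigma> * norm u + \<tau> * norm v"
      using that by (intro order.trans[OF norm_triangle_ineq]) auto
    also have "\<dots> \<le> s * norm u + s * norm v"
      using that by (intro add_mono mult_right_mono) auto
    finally show ?thesis by (simp add: algebra_simps)
  qed
  have in_ball: "z + \<sigma> *\<^sub>R u + \<tau> *\<^sub>R v \<in> ball z r"
    if "\<sigma> \<in> {0..s}" "\<tau> \<in> {0..s}" for \<sigma> \<tau>
    using near[OF that] s by simp
  have df: "((\<lambda>\<tau>. f (z + \<sigma> *\<^sub>R u + \<tau> *\<^sub>R v)) has_derivative
       (\<lambda>h. ?D (z + \<sigma> *\<^sub>R u + \<tau> *\<^sub>R v) (h *\<^sub>R v))) (at \<tau> within {0..s})"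
    if "\<sigma> \<in> {0..s}" "\<tau> \<in> {0..s}" for \<sigma> \<tau>
  proof -
    have 1: "(f has_derivative ?D (z + \<sigma> *\<^sub>R u + \<tau> *\<^sub>R v)) (at (z + \<sigma> *\<^sub>R u + \<tau> *\<^sub>R v))"
      using f[OF in_ball[OF that]] frechet_derivative_works by blast
    have 2: "((\<lambda>\<tau>. z + \<sigma> *\<^sub>R u + \<tau> *\<^sub>R v) has_derivative (\<lambda>h. h *\<^sub>R v)) (at \<tau> within {0..s})"
      by (auto intro!: derivative_eq_intros)
    show ?thesis using has_derivative_compose[OF 2 1] by simp
  qed
  have "\<exists>\<tau>\<in>{0<..<s}. (\<lambda>\<tau>. (f (z + s *\<^sub>R u + \<tau> *\<^sub>R v) - f (z + 0 *\<^sub>R u + \<tau> *\<^sub>R v)) \<bullet> e) s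
        - (\<lambda>\<tau>. (f (z + s *\<^sub>R u + \<tau> *\<^sub>R v) - f (z + 0 *\<^sub>R u + \<tau> *\<^sub>R v)) \<bullet> e) 0
      = (\<lambda>\<tau> h. (?D (z + s *\<^sub>R u + \<tau> *\<^sub>R v) (h *\<^sub>R v) - ?D (z + 0 *\<^sub>R u + \<tau> *\<^sub>R v) (h *\<^sub>R v)) \<bullet> e) \<tau> (s - 0)"
    by (rule mvt_simple[OF s(1)], rule has_derivative_inner_left, (rule has_derivative_diff; rule df))
       (use s in auto)
  then obtain \<tau> where \<tau>: "\<tau> \<in> {0<..<s}"
    and "(f (z + s *\<^sub>R u + s *\<^sub>R v) - f (z + s *\<^sub>R u) - f (z + s *\<^sub>R v) + f z) \<bullet> e
      = (?D (z + s *\<^sub>R u + \<tau> *\<^sub>R v) (s *\<^sub>R v) - ?D (z + 0 *\<^sub>R u + \<tau> *\<^sub>R v) (s *\<^sub>R v)) \<bullet> e"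
    by (auto simp: algebra_simps)
  moreover have "?D (z + \<sigma> *\<^sub>R u + \<tau> *\<^sub>R v) (s *\<^sub>R v) = s *\<^sub>R ?D (z + \<sigma> *\<^sub>R u + \<tau> *\<^sub>R v) v"
    if "\<sigma> \<in> {0..s}" for \<sigma>
    using f[OF in_ball] that \<tau> by (intro linear_cmul linear_frechet_derivative) auto
  ultimately have 1: "(f (z + s *\<^sub>R u + s *\<^sub>R v) - f (z + s *\<^sub>R u) - f (z + s *\<^sub>R v) + f z) \<bullet> e
      = s * ((?D (z + s *\<^sub>R u + \<tau> *\<^sub>R v) v - ?D (z + 0 *\<^sub>R u + \<tau> *\<^sub>R v) v) \<bullet> e)"
    using s by (simp del: scaleR_zero_left add_0_right flip: scaleR_right_diff_distrib)
  have dfv: "((\<lambda>\<sigma>. ?D (z + \<sigma> *\<^sub>R u + \<tau> *\<^sub>R v) v) has_derivative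
       (\<lambda>h. ?D2 (z + \<sigma> *\<^sub>R u + \<tau> *\<^sub>R v) (h *\<^sub>R u))) (at \<sigma> within {0..s})"
    if "\<sigma> \<in> {0..s}" for \<sigma>
  proof -
    have 1: "((\<lambda>y. ?D y v) has_derivative ?D2 (z + \<sigma> *\<^sub>R u + \<tau> *\<^sub>R v)) (at (z + \<sigma> *\<^sub>R u + \<tau> *\<^sub>R v))"
      using fv[OF in_ball] that \<tau> frechet_derivative_works by fastforce
    have 2: "((\<lambda>\<sigma>. z + \<sigma> *\<^sub>R u + \<tau> *\<^sub>R v) has_derivative (\<lambda>h. h *\<^sub>R u)) (at \<sigma> within {0..s})"
      by (auto intro!: derivative_eq_intros)
    show ?thesis using has_derivative_compose[OF 2 1] by simp
  qed
  have "\<exists>\<sigma>\<in>{0<..<s}. (\<lambda>\<sigma>. ?D (z + \<sigma> *\<^sub>R u + \<tau> *\<^sub>R v) v \<bullet> e) s - (\<lambda>\<sigma>. ?D (z + \<sigma> *\<^sub>R u + \<tau> *\<^sub>R v) v \<bullet> e) 0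
      = (\<lambda>\<sigma> h. ?D2 (z + \<sigma> *\<^sub>R u + \<tau> *\<^sub>R v) (h *\<^sub>R u) \<bullet> e) \<sigma> (s - 0)"
    by (rule mvt_simple[OF s(1)], rule has_derivative_inner_left) (auto intro!: dfv)
  then obtain \<sigma> where \<sigma>: "\<sigma> \<in> {0<..<s}"
    and "(?D (z + s *\<^sub>R u + \<tau> *\<^sub>R v) v - ?D (z + 0 *\<^sub>R u + \<tau> *\<^sub>R v) v) \<bullet> e
       = ?D2 (z + \<sigma> *\<^sub>R u + \<tau> *\<^sub>R v) (s *\<^sub>R u) \<bullet> e"
    by (auto simp: inner_diff_left)
  moreover have "?D2 (z + \<sigma> *\<^sub>R u + \<tau> *\<^sub>R v) (s *\<^sub>R u) = s *\<^sub>R ?D2 (z + \<sigma> *\<^sub>R u + \<tau> *\<^sub>R v) u"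
    using fv[OF in_ball] \<sigma> \<tau> by (intro linear_cmul linear_frechet_derivative) auto
  ultimately show ?thesis
    using that[OF near[of \<sigma> \<tau>]] 1 \<sigma> \<tau> by (simp add: power2_eq_square)
qed

lemma smooth_on_imp_C2:
  assumes "smooth_on U f"
  shows "x \<in> U \<Longrightarrow> f differentiable (at x)"
    and "x \<in> U \<Longrightarrow> (\<lambda>y. frechet_derivative f (at y) v) differentiable (at x)"
    and "continuous_on U (\<lambda>x. frechet_derivative (\<lambda>y. frechet_derivative f (at y) v) (at x) u)"
  using assms[unfolded smooth_on_def, rule_format, of "Suc (Suc 0)"] by auto

text \<open>The second difference of \<open>f\<close> at \<open>z\<close> with steps \<open>s u\<close> and \<open>s v\<close> is symmetric in \<open>u\<close> and
  \<open>v\<close>. Hence both mixed derivatives, taken at two points within \<open>s (norm u + norm v)\<close> of \<open>z\<close>, equal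
  the same quotient by \<open>s\<^sup>2\<close>, and continuity gives equality at \<open>z\<close> as \<open>s\<close> tends to \<open>0\<close>.\<close>

lemma second_derivative_symmetric:
  fixes f :: "'a::euclidean_space \<Rightarrow> 'b::euclidean_space"
  assumes "open U" and f: "smooth_on U f" and z: "z \<in> U"
  shows "frechet_derivative (\<lambda>y. frechet_derivative f (at y) v) (at z) u
       = frechet_derivative (\<lambda>y. frechet_derivative f (at y) u) (at z) v"
proof (rule euclidean_eqI)
  fix e :: 'b
  let ?D2 = "\<lambda>u v x. frechet_derivative (\<lambda>y. frechet_derivative f (at y) v) (at x) u"
  obtain r where r: "r > 0" "ball z r \<subseteq> U"
    using assms(1) z open_contains_ball by blast
  \<comment> \<open>The added \<open>1\<close> keeps the denominator positive and the points strictly inside the ball.\<close>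
  define s where "s n = r / (norm u + norm v + 1) * inverse (real (Suc n))" for n
  have s: "0 < s n" "s n * (norm u + norm v) < r" for n
  proof -
    have pos: "norm u + norm v + 1 > 0"
      using norm_ge_zero[of u] norm_ge_zero[of v] by linarith
    then show "0 < s n" using r by (simp add: s_def)
    have "s n \<le> r / (norm u + norm v + 1)"
      unfolding s_def using r pos
      by (intro mult_right_le_one_le) (auto simp: inverse_le_1_iff)
    then have "s n * (norm u + norm v) \<le> r / (norm u + norm v + 1) * (norm u + norm v)"
      by (intro mult_right_mono) auto
    also have "\<dots> < r"
      using r pos by (simp add: pos_divide_less_eq algebra_simps)
    finally show "s n * (norm u + norm v) < r" .
  qed
  have lim: "(\<lambda>n. s n * (norm u + norm v)) \<longlonglongrightarrow> 0"
    unfolding s_def by (intro tendsto_mult_left_zero tendsto_mult_right_zero LIMSEQ_inverse_real_of_nat)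
  define \<Delta> where "\<Delta> n = (f (z + s n *\<^sub>R u + s n *\<^sub>R v) - f (z + s n *\<^sub>R u) - f (z + s n *\<^sub>R v) + f z) \<bullet> e" for n
  have mean: "\<exists>x. dist z x \<le> s n * (norm u' + norm v') \<and>
      (f (z + s n *\<^sub>R u' + s n *\<^sub>R v') - f (z + s n *\<^sub>R u') - f (z + s n *\<^sub>R v') + f z) \<bullet> e
        = (s n)\<^sup>2 * (?D2 u' v' x \<bullet> e)"
    if "norm u' + norm v' = norm u + norm v" for n u' v'
    by (rule second_difference_mean_value[of z r f v' "s n" u' e])
       (use that r s[of n] smooth_on_imp_C2(1,2)[OF f] in auto)
  have "\<exists>x. dist z x \<le> s n * (norm u + norm v) \<and> \<Delta> n = (s n)\<^sup>2 * (?D2 u v x \<bullet> e)" for n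
    using mean[of u v n] by (simp add: \<Delta>_def)
  then obtain x where x: "\<And>n. dist z (x n) \<le> s n * (norm u + norm v)"
      "\<And>n. \<Delta> n = (s n)\<^sup>2 * (?D2 u v (x n) \<bullet> e)" by metis
  have "\<exists>y. dist z y \<le> s n * (norm u + norm v) \<and> \<Delta> n = (s n)\<^sup>2 * (?D2 v u y \<bullet> e)" for n
    using mean[of v u n] by (simp add: \<Delta>_def algebra_simps)
  then obtain y where y: "\<And>n. dist z (y n) \<le> s n * (norm u + norm v)"
      "\<And>n. \<Delta> n = (s n)\<^sup>2 * (?D2 v u (y n) \<bullet> e)" by metis
  have conv: "(\<lambda>n. ?D2 u' v' (w n) \<bullet> e) \<longlonglongrightarrow> ?D2 u' v' z \<bullet> e"
    if w: "\<And>n. dist z (w n) \<le> s n * (norm u + norm v)" for w u' v'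
  proof -
    have "(\<lambda>n. dist (w n) z) \<longlonglongrightarrow> 0"
      using w by (intro Lim_null_comparison[OF _ lim]) (auto simp: dist_commute)
    then have "w \<longlonglongrightarrow> z" by (rule iffD2[OF tendsto_dist_iff])
    moreover have "isCont (?D2 u' v') z"
      using smooth_on_imp_C2(3)[OF f, of v' u'] z by (simp only: continuous_on_eq_continuous_at[OF assms(1)])
    ultimately show ?thesis
      by (intro tendsto_inner tendsto_const isCont_tendsto_compose[of z "?D2 u' v'" w])
  qed
  have "?D2 u v (x n) \<bullet> e = ?D2 v u (y n) \<bullet> e" for n
    using x(2)[of n] y(2)[of n] s(1)[of n] by simp
  then show "?D2 u v z \<bullet> e = ?D2 v u z \<bullet> e"
    by (intro LIMSEQ_unique[OF conv[OF x(1)]]) (simp add: conv[OF y(1)])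
qed

section \<open>Naturality of the exterior derivative\<close>

lemma form2_expand:
  fixes \<omega> :: "'a::euclidean_space form2"
  assumes "bilinear (\<omega> x)"
  shows "\<omega> x X Y = (\<Sum>i\<in>Basis. \<Sum>j\<in>Basis. (X \<bullet> i) * (Y \<bullet> j) * \<omega> x i j)"
proof -
  have "\<omega> x X Y = \<omega> x (\<Sum>i\<in>Basis. (X \<bullet> i) *\<^sub>R i) (\<Sum>j\<in>Basis. (Y \<bullet> j) *\<^sub>R j)"
    by (simp add: euclidean_representation)
  also have "\<dots> = (\<Sum>i\<in>Basis. \<Sum>j\<in>Basis. (X \<bullet> i) * (Y \<bullet> j) * \<omega> x i j)"
    by (simp add: bilinear_sum[OF assms] sum.cartesian_product bilinear_lmul[OF assms]
        bilinear_rmul[OF assms] ac_simps)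
  finally show ?thesis .
qed

text \<open>Differentiability of \<open>\<omega>\<close> is assumed for fixed vector arguments only. Expanding both arguments in the
  basis reduces the moving vectors \<open>A y\<close> and \<open>B y\<close> to finitely many such coefficients.\<close>

lemma has_derivative_form2:
  fixes \<omega> :: "'a::euclidean_space form2" and \<phi> A B :: "'e::euclidean_space \<Rightarrow> 'a"
  assumes bil: "\<And>x. bilinear (\<omega> x)"
    and \<omega>: "\<And>X Y. (\<lambda>x. \<omega> x X Y) differentiable (at (\<phi> z))"
    and \<phi>: "(\<phi> has_derivative \<phi>') (at z)"
    and A: "(A has_derivative A') (at z)" and B: "(B has_derivative B') (at z)"
  shows "((\<lambda>y. \<omega> (\<phi> y) (A y) (B y)) has_derivative
      (\<lambda>h. frechet_derivative (\<lambda>x. \<omega> x (A z) (B z)) (at (\<phi> z)) (\<phi>' h)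
         + \<omega> (\<phi> z) (A' h) (B z) + \<omega> (\<phi> z) (A z) (B' h))) (at z)"
proof -
  define D where "D X Y = frechet_derivative (\<lambda>x. \<omega> x X Y) (at (\<phi> z))" for X Y
  have D: "((\<lambda>x. \<omega> x X Y) has_derivative D X Y) (at (\<phi> z))" for X Y
    unfolding D_def using \<omega> frechet_derivative_works by blast
  have expand: "\<omega> x X Y = (\<Sum>i\<in>Basis. \<Sum>j\<in>Basis. (X \<bullet> i) * (Y \<bullet> j) * \<omega> x i j)" for x X Y
    by (rule form2_expand[OF bil])
  have "((\<lambda>x. \<Sum>i\<in>Basis. \<Sum>j\<in>Basis. (A z \<bullet> i) * (B z \<bullet> j) * \<omega> x i j) has_derivative
      (\<lambda>H. \<Sum>i\<in>Basis. \<Sum>j\<in>Basis. (A z \<bullet> i) * (B z \<bullet> j) * D i j H)) (at (\<phi> z))"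
    by (intro has_derivative_sum has_derivative_mult_right D)
  then have "((\<lambda>x. \<omega> x (A z) (B z)) has_derivative
        (\<lambda>H. \<Sum>i\<in>Basis. \<Sum>j\<in>Basis. (A z \<bullet> i) * (B z \<bullet> j) * D i j H)) (at (\<phi> z))"
    by (simp only: expand[of _ "A z" "B z"])
  from fun_cong[OF has_derivative_unique[OF D this]]
  have D_expand: "D (A z) (B z) H = (\<Sum>i\<in>Basis. \<Sum>j\<in>Basis. (A z \<bullet> i) * (B z \<bullet> j) * D i j H)" for H .
  have \<omega>\<phi>: "((\<lambda>y. \<omega> (\<phi> y) i j) has_derivative (\<lambda>h. D i j (\<phi>' h))) (at z)" for i j
    using has_derivative_compose[OF \<phi> D] .
  have "((\<lambda>y. \<Sum>i\<in>Basis. \<Sum>j\<in>Basis. (A y \<bullet> i) * (B y \<bullet> j) * \<omega> (\<phi> y) i j) has_derivative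
      (\<lambda>h. \<Sum>i\<in>Basis. \<Sum>j\<in>Basis. (A z \<bullet> i) * (B z \<bullet> j) * D i j (\<phi>' h)
         + ((A z \<bullet> i) * (B' h \<bullet> j) + (A' h \<bullet> i) * (B z \<bullet> j)) * \<omega> (\<phi> z) i j)) (at z)"
    by (intro has_derivative_sum has_derivative_mult has_derivative_inner_left A B \<omega>\<phi>)
  then have "((\<lambda>y. \<omega> (\<phi> y) (A y) (B y)) has_derivative
      (\<lambda>h. \<Sum>i\<in>Basis. \<Sum>j\<in>Basis. (A z \<bullet> i) * (B z \<bullet> j) * D i j (\<phi>' h)
         + ((A z \<bullet> i) * (B' h \<bullet> j) + (A' h \<bullet> i) * (B z \<bullet> j)) * \<omega> (\<phi> z) i j)) (at z)"
    by (simp only: expand[of "\<phi> y" "A y" "B y" for y])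
  moreover have "(\<Sum>i\<in>Basis. \<Sum>j\<in>Basis. (A z \<bullet> i) * (B z \<bullet> j) * D i j (\<phi>' h)
         + ((A z \<bullet> i) * (B' h \<bullet> j) + (A' h \<bullet> i) * (B z \<bullet> j)) * \<omega> (\<phi> z) i j)
     = D (A z) (B z) (\<phi>' h) + \<omega> (\<phi> z) (A' h) (B z) + \<omega> (\<phi> z) (A z) (B' h)" for h
    unfolding D_expand expand[of _ "A' h" "B z"] expand[of _ "A z" "B' h"]
    by (simp add: sum.distrib distrib_right add_ac)
  ultimately show ?thesis by (simp add: D_def)
qed

text \<open>Differentiating a pulled back coefficient \<open>\<omega> (\<phi> y) (D\<phi> u) (D\<phi> v)\<close> gives the derivative of \<open>\<omega>\<close>
  and two terms with second derivatives of \<open>\<phi>\<close>. In the alternating sum the latter cancel in pairs,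
  because they are symmetric and \<open>\<omega>\<close> is alternating. A 2-form on a submanifold that extends to an
  ambient form can thus be differentiated in the ambient space.\<close>

lemma ext_deriv2_pullback2:
  fixes \<omega> :: "'a::euclidean_space form2" and \<phi> :: "'e::euclidean_space \<Rightarrow> 'a"
  assumes U: "open U" "smooth_on U \<phi>" "z \<in> U"
    and bil: "\<And>x. bilinear (\<omega> x)"
    and alt: "\<And>x X Y. \<omega> x X Y = - \<omega> x Y X"
    and \<omega>: "\<And>X Y. (\<lambda>x. \<omega> x X Y) differentiable (at (\<phi> z))"
  shows "(\<lambda>y. pullback2 \<phi> \<omega> y u v) differentiable (at z)"
    and "ext_deriv2 (pullback2 \<phi> \<omega>) z u v w = pullback3 \<phi> (ext_deriv2 \<omega>) z u v w"
proof -
  let ?D = "\<lambda>y u. frechet_derivative \<phi> (at y) u"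
  let ?D2 = "\<lambda>u v. frechet_derivative (\<lambda>y. ?D y v) (at z) u"
  have "((\<lambda>y. pullback2 \<phi> \<omega> y u v) has_derivative
      (\<lambda>h. frechet_derivative (\<lambda>x. \<omega> x (?D z u) (?D z v)) (at (\<phi> z)) (?D z h)
         + \<omega> (\<phi> z) (?D2 h u) (?D z v) + \<omega> (\<phi> z) (?D z u) (?D2 h v))) (at z)" for u v
    unfolding pullback2_def
    by (rule has_derivative_form2[where \<phi> = \<phi> and z = z, OF bil \<omega>])
       (use smooth_on_imp_C2(1,2)[OF U(2,3)] in \<open>simp_all add: frechet_derivative_works\<close>)
  note * = this
  show "(\<lambda>y. pullback2 \<phi> \<omega> y u v) differentiable (at z)"
    using * differentiable_def by blast
  have sym: "?D2 u v = ?D2 v u" for u v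
    by (rule second_derivative_symmetric[OF U])
  show "ext_deriv2 (pullback2 \<phi> \<omega>) z u v w = pullback3 \<phi> (ext_deriv2 \<omega>) z u v w"
    unfolding ext_deriv2_def pullback3_def frechet_derivative_at[OF *, symmetric]
    using sym[of u v] sym[of u w] sym[of v w]
      alt[of "\<phi> z" "?D z u"] alt[of "\<phi> z" "?D z v"] alt[of "\<phi> z" "?D z w"]
    by simp
qed

text \<open>A parametrisation maps an open set into \<open>M\<close>, so forms that agree on \<open>M\<close> have pullbacks that agree
  near each point. This allows a form given only on \<open>M\<close>, such as one that involves the inverse
  Legendre transform, to be replaced by a convenient ambient extension.\<close>

lemma has_exterior_derivative_on_cong:
  fixes \<omega> \<omega>' :: "'a::euclidean_space form2"
  assumes eq: "\<And>x X Y. x \<in> M \<Longrightarrow> \<omega> x X Y = \<omega>' x X Y"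
    and \<omega>': "has_exterior_derivative_on \<omega>' \<eta> M"
  shows "has_exterior_derivative_on \<omega> \<eta> M"
  unfolding has_exterior_derivative_on_def
proof (intro allI impI ballI)
  fix U and \<phi> :: "real^4 \<Rightarrow> 'a" and z assume \<phi>: "local_param M U \<phi>" and z: "z \<in> U"
  then have U: "open U" and "\<And>y. y \<in> U \<Longrightarrow> \<phi> y \<in> M"
    by (auto simp: local_param_def)
  then have eq': "pullback2 \<phi> \<omega>' y u v = pullback2 \<phi> \<omega> y u v" if "y \<in> U" for y u v
    using that eq by (simp add: pullback2_def)
  have diff: "(\<lambda>y. pullback2 \<phi> \<omega>' y u v) differentiable (at z)" for u v
    using \<omega>' \<phi> z by (auto simp: has_exterior_derivative_on_def)
  have diff': "(\<lambda>y. pullback2 \<phi> \<omega> y u v) differentiable (at z)" for u v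
  proof -
    obtain d where "((\<lambda>y. pullback2 \<phi> \<omega>' y u v) has_derivative d) (at z)"
      using diff by (auto simp: differentiable_def)
    then have "((\<lambda>y. pullback2 \<phi> \<omega> y u v) has_derivative d) (at z)"
      by (rule has_derivative_transform_within_open[OF _ U z eq'])
    then show ?thesis by (auto simp: differentiable_def)
  qed
  have "ext_deriv2 (pullback2 \<phi> \<omega>) z u v w = ext_deriv2 (pullback2 \<phi> \<omega>') z u v w" for u v w
    unfolding ext_deriv2_def
    using frechet_derivative_transform_within_open[OF diff U z eq'] by simp
  with diff' \<omega>' \<phi> z show "(\<forall>u v. (\<lambda>y. pullback2 \<phi> \<omega> y u v) differentiable (at z)) \<and>
      (\<forall>u v w. ext_deriv2 (pullback2 \<phi> \<omega>) z u v w = pullback3 \<phi> \<eta> z u v w)"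
    by (auto simp: has_exterior_derivative_on_def)
qed

section \<open>Closed forms on the cotangent bundle of the sphere\<close>

lemma tangent_cross:
  fixes \<gamma> u v :: "real^3"
  assumes "norm \<gamma> = 1" "\<gamma> \<bullet> u = 0" "\<gamma> \<bullet> v = 0"
  shows "cross3 u v = area_S2 \<gamma> u v *\<^sub>R \<gamma>"
proof -
  have "cross3 \<gamma> (cross3 \<gamma> (cross3 u v)) = 0"
    using assms by (simp add: Lagrange)
  then have "(\<gamma> \<bullet> cross3 u v) *\<^sub>R \<gamma> - (\<gamma> \<bullet> \<gamma>) *\<^sub>R cross3 u v = 0"
    by (simp only: Lagrange[of \<gamma> \<gamma> "cross3 u v"])
  moreover have "\<gamma> \<bullet> \<gamma> = 1" using assms by (simp add: dot_square_norm)
  ultimately show ?thesis by (simp add: area_S2_def)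
qed

text \<open>The ambient form \<open>f (\<omega>\<^sub>c\<^sub>a\<^sub>n + (p, \<xi>) dS\<^sup>2)\<close> for a function \<open>f\<close> and a vector field \<open>\<xi>\<close> on the
  base: a semi-basic perturbation of the canonical form that is linear in the momentum.\<close>

definition gyroscopic_form ::
  "(real^3 \<Rightarrow> real) \<Rightarrow> (real^3 \<Rightarrow> real^3) \<Rightarrow> ((real^3) \<times> (real^3)) form2" where
  "gyroscopic_form f \<xi> x X Y = f (fst x) *
     (omega_can x X Y + (snd x \<bullet> \<xi> (fst x)) * area_S2 (fst x) (fst X) (fst Y))"

lemma bilinear_gyroscopic_form: "bilinear (gyroscopic_form f \<xi> x)"
  unfolding bilinear_def linear_iff gyroscopic_form_def omega_can_def area_S2_def
  by (simp add: inner_add_left inner_add_right cross_add_left cross_add_right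
      cross_mult_left cross_mult_right algebra_simps)

lemma gyroscopic_form_alternating: "gyroscopic_form f \<xi> x X Y = - gyroscopic_form f \<xi> x Y X"
  using cross_skew[of "fst X" "fst Y"]
  by (simp add: gyroscopic_form_def omega_can_def area_S2_def algebra_simps)

lemma has_derivative_gyroscopic_form:
  assumes f: "(f has_derivative f') (at (fst x))" and \<xi>: "(\<xi> has_derivative \<xi>') (at (fst x))"
  shows "((\<lambda>x. gyroscopic_form f \<xi> x X Y) has_derivative
     (\<lambda>H. f' (fst H) * (omega_can x X Y + (snd x \<bullet> \<xi> (fst x)) * area_S2 (fst x) (fst X) (fst Y))
        + f (fst x) * ((snd H \<bullet> \<xi> (fst x) + snd x \<bullet> \<xi>' (fst H)) * area_S2 (fst x) (fst X) (fst Y)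
            + (snd x \<bullet> \<xi> (fst x)) * area_S2 (fst H) (fst X) (fst Y)))) (at x)"
proof -
  have fst: "(fst has_derivative fst) (at x)" and snd: "(snd has_derivative snd) (at x)"
    by (auto intro: bounded_linear_imp_has_derivative bounded_linear_fst bounded_linear_snd)
  note [derivative_intros] = fst snd has_derivative_compose[OF fst f] has_derivative_compose[OF fst \<xi>]
  show ?thesis
    unfolding gyroscopic_form_def omega_can_def area_S2_def
    by (auto intro!: derivative_eq_intros simp: fun_eq_iff algebra_simps)
qed

text \<open>The exterior derivative of \<open>f (\<omega>\<^sub>c\<^sub>a\<^sub>n + (p, \<xi>) dS\<^sup>2)\<close> is
  \<open>df \<and> \<omega>\<^sub>c\<^sub>a\<^sub>n + f d(p, \<xi>) \<and> dS\<^sup>2\<close> up to terms that are 3-forms on the 2-dimensional base and hence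
  vanish. What is left is linear in the momentum components of the three vectors and vanishes
  for every momentum component exactly when, with \<open>g = grad f\<close>,
  \<open>f dS\<^sup>2(y, z) \<xi>\<close> and \<open>(g, y) z - (g, z) y\<close> have the same tangential part. As
  \<open>y \<times> z = dS\<^sup>2(y, z) \<gamma>\<close>, the second vector is \<open>(y \<times> z) \<times> g = dS\<^sup>2(y, z) \<gamma> \<times> g\<close>, so the condition
  is \<open>f \<xi> = \<gamma> \<times> g\<close>.\<close>

lemma gyroscopic_form_closed_on_tangent_vectors:
  assumes f: "(f has_derivative (\<lambda>y. g \<bullet> y)) (at \<gamma>)" and \<xi>: "\<xi> differentiable (at \<gamma>)"
    and eq: "f \<gamma> *\<^sub>R \<xi> \<gamma> = cross3 \<gamma> g" and \<gamma>: "norm \<gamma> = 1"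
    and tangent: "\<gamma> \<bullet> fst X = 0" "\<gamma> \<bullet> fst Y = 0" "\<gamma> \<bullet> fst Z = 0"
  shows "ext_deriv2 (gyroscopic_form f \<xi>) (\<gamma>, p) X Y Z = 0"
proof -
  obtain \<xi>' where \<xi>': "(\<xi> has_derivative \<xi>') (at \<gamma>)"
    using \<xi> by (auto simp: differentiable_def)
  then have lin: "linear \<xi>'" by (rule has_derivative_linear)
  let ?s = "area_S2 \<gamma>"
  obtain x u where X: "X = (x, u)" by (cases X)
  obtain y v where Y: "Y = (y, v)" by (cases Y)
  obtain z w where Z: "Z = (z, w)" by (cases Z)
  have tan: "\<gamma> \<bullet> x = 0" "\<gamma> \<bullet> y = 0" "\<gamma> \<bullet> z = 0" using tangent by (auto simp: X Y Z)
  have fibre: "f \<gamma> * (q \<bullet> \<xi> \<gamma>) * ?s u v = (g \<bullet> u) * (q \<bullet> v) - (g \<bullet> v) * (q \<bullet> u)"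
    if "\<gamma> \<bullet> u = 0" "\<gamma> \<bullet> v = 0" for q u v
  proof -
    have "f \<gamma> * (q \<bullet> \<xi> \<gamma>) * ?s u v = q \<bullet> cross3 (?s u v *\<^sub>R \<gamma>) g"
      by (simp add: cross_mult_left flip: eq)
    also have "?s u v *\<^sub>R \<gamma> = cross3 u v" using tangent_cross[OF \<gamma> that] by simp
    also have "cross3 (cross3 u v) g = (g \<bullet> u) *\<^sub>R v - (g \<bullet> v) *\<^sub>R u"
      using cross_skew[of "cross3 u v" g] by (simp add: Lagrange)
    finally show ?thesis by (simp add: inner_diff_right)
  qed
  have vol0: "area_S2 u x y = 0" if "\<gamma> \<bullet> u = 0" "\<gamma> \<bullet> x = 0" "\<gamma> \<bullet> y = 0" for u x y
  proof -
    have "area_S2 u x y = u \<bullet> (?s x y *\<^sub>R \<gamma>)"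
      using tangent_cross[OF \<gamma> that(2,3)] by (simp only: area_S2_def[of u])
    then show ?thesis using that(1) by (simp add: inner_commute)
  qed
  \<comment> \<open>Four vectors of a 3-dimensional space satisfy a linear relation with determinants as coefficients;
    that of \<open>\<gamma>\<close> is the volume of \<open>x\<close>, \<open>y\<close>, \<open>z\<close>, which lie in one plane.\<close>
  have base: "?s y z *\<^sub>R x - ?s x z *\<^sub>R y + ?s x y *\<^sub>R z = 0"
  proof -
    have "?s y z *\<^sub>R x - ?s x z *\<^sub>R y + ?s x y *\<^sub>R z = area_S2 x y z *\<^sub>R \<gamma>"
      by (simp add: area_S2_def vec_eq_iff forall_3 cross3_def inner_vec_def sum_3 algebra_simps)
    then show ?thesis using vol0[OF tan] by simp
  qed
  have linear_zero: "?s y z * \<phi> x - ?s x z * \<phi> y + ?s x y * \<phi> z = 0" if "linear \<phi>" for \<phi> :: "real^3 \<Rightarrow> real"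
    using arg_cong[OF base, of \<phi>] that by (simp add: linear_add linear_diff linear_cmul linear_0)
  have p\<xi>: "linear (\<lambda>y. p \<bullet> \<xi>' y)"
    using lin by (simp add: linear_iff inner_add_right)
  have "linear (\<lambda>y. g \<bullet> y)" by (simp add: linear_iff inner_add_right)
  note base_zero = linear_zero[OF this] linear_zero[OF p\<xi>]
  note D = has_derivative_gyroscopic_form[of f _ "(\<gamma>, p)" \<xi>, simplified, OF f \<xi>',
      THEN frechet_derivative_at, symmetric]
  \<comment> \<open>The first bracket collects the terms with a momentum component; each other bracket is a 3-form on the base.\<close>
  have "ext_deriv2 (gyroscopic_form f \<xi>) (\<gamma>, p) X Y Z =
      ((g \<bullet> x) * (v \<bullet> z - w \<bullet> y) - (g \<bullet> y) * (u \<bullet> z - w \<bullet> x) + (g \<bullet> z) * (u \<bullet> y - v \<bullet> x)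
       + f \<gamma> * (u \<bullet> \<xi> \<gamma>) * ?s y z - f \<gamma> * (v \<bullet> \<xi> \<gamma>) * ?s x z + f \<gamma> * (w \<bullet> \<xi> \<gamma>) * ?s x y)
      + (p \<bullet> \<xi> \<gamma>) * (?s y z * (g \<bullet> x) - ?s x z * (g \<bullet> y) + ?s x y * (g \<bullet> z))
      + f \<gamma> * (?s y z * (p \<bullet> \<xi>' x) - ?s x z * (p \<bullet> \<xi>' y) + ?s x y * (p \<bullet> \<xi>' z))
      + f \<gamma> * (p \<bullet> \<xi> \<gamma>) * (area_S2 x y z - area_S2 y x z + area_S2 z x y)"
    unfolding ext_deriv2_def D by (simp add: X Y Z omega_can_def algebra_simps)
  also have "\<dots> = 0"
    using tan by (simp only: base_zero fibre vol0) (simp add: algebra_simps)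
  finally show ?thesis .
qed

text \<open>The linearised equations of the cotangent bundle, \<open>(\<gamma>, \<gamma>) = 1\<close> and \<open>(\<gamma>, p) = 0\<close>. They apply both to
  parametrisations, where \<open>c\<close> stays in the bundle near \<open>z\<close>, and to curves.\<close>

lemma tangent_of_curve_in_cotangent_S2:
  assumes "eventually (\<lambda>y. c y \<in> cotangent_S2) (at z)" "c z \<in> cotangent_S2"
    and c: "(c has_derivative c') (at z)"
  shows "fst (c z) \<bullet> fst (c' h) = 0" "fst (c z) \<bullet> snd (c' h) + fst (c' h) \<bullet> snd (c z) = 0"
proof -
  have ev: "eventually (\<lambda>y. fst (c y) \<bullet> fst (c y) = 1) (nhds z)"
      "eventually (\<lambda>y. fst (c y) \<bullet> snd (c y) = 0) (nhds z)"
    using assms(1,2) unfolding eventually_nhds_conv_at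
    by (auto simp: cotangent_S2_def sphere_tangent_def dot_square_norm case_prod_beta elim!: eventually_mono)
  have "((\<lambda>y. 1) has_derivative (\<lambda>h. fst (c z) \<bullet> fst (c' h) + fst (c' h) \<bullet> fst (c z))) (at z)"
    by (rule has_derivative_transform_eventually[OF has_derivative_inner[OF has_derivative_fst has_derivative_fst]])
       (use c ev in \<open>auto simp: eventually_nhds_conv_at\<close>)
  from has_derivative_unique[OF this has_derivative_const]
  show "fst (c z) \<bullet> fst (c' h) = 0"
    by (simp add: fun_eq_iff inner_commute)
  have "((\<lambda>y. 0) has_derivative (\<lambda>h. fst (c z) \<bullet> snd (c' h) + fst (c' h) \<bullet> snd (c z))) (at z)"
    by (rule has_derivative_transform_eventually[OF has_derivative_inner[OF has_derivative_fst has_derivative_snd]])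
       (use c ev in \<open>auto simp: eventually_nhds_conv_at\<close>)
  from has_derivative_unique[OF this has_derivative_const]
  show "fst (c z) \<bullet> snd (c' h) + fst (c' h) \<bullet> snd (c z) = 0"
    by (simp add: fun_eq_iff)
qed

lemma gyroscopic_form_closed:
  assumes f: "\<And>\<gamma>. norm \<gamma> = 1 \<Longrightarrow> (f has_derivative (\<lambda>y. g \<gamma> \<bullet> y)) (at \<gamma>)"
    and \<xi>: "\<And>\<gamma>. norm \<gamma> = 1 \<Longrightarrow> \<xi> differentiable (at \<gamma>)"
    and eq: "\<And>\<gamma>. norm \<gamma> = 1 \<Longrightarrow> f \<gamma> *\<^sub>R \<xi> \<gamma> = cross3 \<gamma> (g \<gamma>)"
  shows "has_exterior_derivative_on (gyroscopic_form f \<xi>) (\<lambda>_ _ _ _. 0) cotangent_S2"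
  unfolding has_exterior_derivative_on_def
proof (intro allI impI ballI)
  fix U \<phi> z assume \<phi>: "local_param cotangent_S2 U \<phi>" and z: "z \<in> U"
  then have U: "open U" "smooth_on U \<phi>" and M: "\<And>y. y \<in> U \<Longrightarrow> \<phi> y \<in> cotangent_S2"
    by (auto simp: local_param_def)
  obtain \<gamma> p where \<phi>z: "\<phi> z = (\<gamma>, p)" by (cases "\<phi> z")
  have \<gamma>: "norm \<gamma> = 1" using M[OF z] by (simp add: \<phi>z cotangent_S2_def)
  obtain \<xi>' where \<xi>': "(\<xi> has_derivative \<xi>') (at \<gamma>)"
    using \<xi>[OF \<gamma>] by (auto simp: differentiable_def)
  have diff: "(\<lambda>x. gyroscopic_form f \<xi> x X Y) differentiable (at (\<phi> z))" for X Y
    using has_derivative_gyroscopic_form[of f _ "\<phi> z" \<xi>] f[OF \<gamma>] \<xi>'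
    unfolding differentiable_def \<phi>z fst_conv by blast
  have "eventually (\<lambda>y. \<phi> y \<in> cotangent_S2) (at z)"
    using U(1) z M by (auto simp: eventually_at_topological)
  then have tangent: "\<gamma> \<bullet> fst (frechet_derivative \<phi> (at z) u) = 0" for u
    using tangent_of_curve_in_cotangent_S2(1)[where c = \<phi> and z = z, OF _ M[OF z]] smooth_on_imp_C2(1)[OF U(2) z]
    unfolding \<phi>z fst_conv frechet_derivative_works by blast
  note pull = ext_deriv2_pullback2[OF U z bilinear_gyroscopic_form gyroscopic_form_alternating diff]
  show "(\<forall>u v. (\<lambda>y. pullback2 \<phi> (gyroscopic_form f \<xi>) y u v) differentiable (at z)) \<and>
      (\<forall>u v w. ext_deriv2 (pullback2 \<phi> (gyroscopic_form f \<xi>)) z u v w = pullback3 \<phi> (\<lambda>_ _ _ _. 0) z u v w)"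
    using pull(1) gyroscopic_form_closed_on_tangent_vectors[OF f[OF \<gamma>] \<xi>[OF \<gamma>] eq[OF \<gamma>] \<gamma>] tangent
    by (simp add: pull(2)) (simp add: pullback3_def \<phi>z)
qed

section \<open>Nondegeneracy\<close>

lemma tangent_vectors_cotangent_S2:
  "tangent_vectors cotangent_S2 (\<gamma>, p) \<subseteq> {(x, u). \<gamma> \<bullet> x = 0 \<and> \<gamma> \<bullet> u + p \<bullet> x = 0}"
proof
  fix X assume "X \<in> tangent_vectors cotangent_S2 (\<gamma>, p)"
  then obtain c where c: "c 0 = (\<gamma>, p)" "\<And>t::real. c t \<in> cotangent_S2"
      "(c has_derivative (\<lambda>h. h *\<^sub>R X)) (at 0)"
    by (auto simp: tangent_vectors_def has_vector_derivative_def)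
  from tangent_of_curve_in_cotangent_S2[OF _ c(2,3), of 1] c(1,2)
  show "X \<in> {(x, u). \<gamma> \<bullet> x = 0 \<and> \<gamma> \<bullet> u + p \<bullet> x = 0}"
    by (auto simp: inner_commute)
qed

lemma vertical_in_tangent_vectors:
  assumes "(\<gamma>, p) \<in> cotangent_S2" "\<gamma> \<bullet> q = 0"
  shows "(0, q) \<in> tangent_vectors cotangent_S2 (\<gamma>, p)"
proof -
  have "((\<lambda>t. (\<gamma>, p + t *\<^sub>R q)) has_vector_derivative (0, q)) (at 0)"
    by (auto intro!: derivative_eq_intros has_vector_derivative_Pair)
  moreover have "(\<gamma>, p + t *\<^sub>R q) \<in> cotangent_S2" for t
    using assms by (simp add: cotangent_S2_def sphere_tangent_def inner_add_right)
  ultimately show ?thesis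
    unfolding tangent_vectors_def by (intro CollectI exI[of _ "\<lambda>t. (\<gamma>, p + t *\<^sub>R q)"]) auto
qed

text \<open>The curve moves \<open>\<gamma>\<close> in the direction \<open>y\<close>, normalised back to the sphere, and projects \<open>p\<close> to the tangent
  plane at the moving point. The derivative of the projection gives the component along \<open>\<gamma>\<close>.\<close>

lemma horizontal_in_tangent_vectors:
  assumes x: "(\<gamma>, p) \<in> cotangent_S2" and y: "\<gamma> \<bullet> y = 0"
  shows "(y, - (p \<bullet> y) *\<^sub>R \<gamma>) \<in> tangent_vectors cotangent_S2 (\<gamma>, p)"
proof -
  have \<gamma>: "\<gamma> \<bullet> \<gamma> = 1" and p: "\<gamma> \<bullet> p = 0"
    using x by (auto simp: cotangent_S2_def sphere_tangent_def dot_square_norm)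
  define N where "N t = inverse (sqrt (1 + t\<^sup>2 * (y \<bullet> y)))" for t
  define c where "c t = N t *\<^sub>R (\<gamma> + t *\<^sub>R y)" for t
  have pos: "1 + t\<^sup>2 * (y \<bullet> y) > 0" for t
    by (intro add_pos_nonneg) auto
  have N: "(N has_real_derivative 0) (at 0)"
    unfolding N_def by (auto intro!: derivative_eq_intros)
  have c: "(c has_vector_derivative y) (at 0)"
    unfolding c_def using N by (auto intro!: derivative_eq_intros simp: N_def)
  have c0: "c 0 = \<gamma>" by (simp add: c_def N_def)
  have cc: "c t \<bullet> c t = 1" for t
  proof -
    have "c t \<bullet> c t = (N t)\<^sup>2 * (1 + t\<^sup>2 * (y \<bullet> y))"
      using \<gamma> y by (simp add: c_def inner_add_left inner_add_right inner_commute power2_eq_square algebra_simps)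
    then show ?thesis using pos[of t] by (simp add: N_def power_inverse)
  qed
  have "((\<lambda>t. (c t, p - (p \<bullet> c t) *\<^sub>R c t)) has_vector_derivative (y, - (p \<bullet> y) *\<^sub>R \<gamma>)) (at 0)"
    using c p unfolding has_vector_derivative_def
    by (auto intro!: derivative_eq_intros simp: c0 inner_commute)
  moreover have "(c t, p - (p \<bullet> c t) *\<^sub>R c t) \<in> cotangent_S2" for t
    using cc[of t] by (simp add: cotangent_S2_def sphere_tangent_def norm_eq_sqrt_inner inner_diff_right inner_commute)
  ultimately show ?thesis
    unfolding tangent_vectors_def using c0 p
    by (intro CollectI exI[of _ "\<lambda>t. (c t, p - (p \<bullet> c t) *\<^sub>R c t)"]) (auto simp: inner_commute)
qed

text \<open>A semi-basic term does not see vertical vectors. If \<open>X = (x, u)\<close> is in the kernel, pairing with the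
  vertical vector \<open>(0, x)\<close> therefore gives \<open>x = 0\<close>; then the semi-basic term vanishes on \<open>X\<close> as well,
  \<open>u\<close> is tangent to the sphere, and pairing with a lift of \<open>u\<close> gives \<open>u = 0\<close>.\<close>

lemma nondegenerate_omega_can_plus_semibasic:
  assumes \<omega>: "\<And>x X Y. x \<in> cotangent_S2 \<Longrightarrow> \<omega> x X Y = omega_can x X Y + h x * area_S2 (fst x) (fst X) (fst Y)"
  shows "nondegenerate_on \<omega> cotangent_S2"
  unfolding nondegenerate_on_def
proof (intro ballI impI)
  fix m X assume m: "m \<in> cotangent_S2" and X: "X \<in> tangent_vectors cotangent_S2 m"
    and zero: "\<forall>Y\<in>tangent_vectors cotangent_S2 m. \<omega> m X Y = 0"
  obtain \<gamma> p where mp: "m = (\<gamma>, p)" by (cases m)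
  obtain x u where Xx: "X = (x, u)" by (cases X)
  have x: "\<gamma> \<bullet> x = 0" and u: "\<gamma> \<bullet> u + p \<bullet> x = 0"
    using X tangent_vectors_cotangent_S2 by (auto simp: mp Xx)
  have "\<omega> m X (0, x) = 0"
    using zero vertical_in_tangent_vectors[of \<gamma> p x] m x by (simp add: mp)
  then have x0: "x = 0"
    using m by (simp add: \<omega> Xx omega_can_def area_S2_def)
  with u have "\<gamma> \<bullet> u = 0" by simp
  then have "\<omega> m X (u, - (p \<bullet> u) *\<^sub>R \<gamma>) = 0"
    using zero horizontal_in_tangent_vectors[of \<gamma> p u] m by (simp add: mp)
  then have "u = 0"
    using m x0 by (simp add: \<omega> Xx omega_can_def area_S2_def)
  with x0 show "X = 0" by (simp add: Xx zero_prod_def)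
qed

section \<open>The conformal factor of the rubber rolling ball\<close>

text \<open>With \<open>m = \<mu> b\<^sup>2\<close>, this is half the gradient of \<open>F / (1 + b/a)\<^sup>2\<close>, which is a quadratic form plus
  the constant \<open>m\<^sup>2\<close>. In terms of \<open>A\<close> it is \<open>det A A\<^sup>-\<^sup>1 \<gamma> + m (tr A \<gamma> - A \<gamma>)\<close>.\<close>

definition half_grad_F :: "real \<Rightarrow> real \<Rightarrow> real \<Rightarrow> real \<Rightarrow> real^3 \<Rightarrow> real^3" where
  "half_grad_F m I1 I2 I3 \<gamma> = vector [(I2 * I3 + m * (I2 + I3)) * \<gamma>$1,
     (I1 * I3 + m * (I1 + I3)) * \<gamma>$2, (I1 * I2 + m * (I1 + I2)) * \<gamma>$3]"

lemma linear_half_grad_F: "linear (half_grad_F m I1 I2 I3)"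
  by (simp add: linear_iff half_grad_F_def vec_eq_iff forall_3 algebra_simps)

lemma matrix_inv_inertia:
  assumes "I1 > 0" "I2 > 0" "I3 > 0"
  shows "matrix_inv (inertia I1 I2 I3) *v \<gamma> = vector [\<gamma>$1 / I1, \<gamma>$2 / I2, \<gamma>$3 / I3]"
proof -
  let ?A = "inertia I1 I2 I3" and ?B = "inertia (1/I1) (1/I2) (1/I3)"
  have "?A ** ?B = mat 1 \<and> ?B ** ?A = mat 1"
    using assms by (simp add: matrix_eq inertia_mult vec_eq_iff forall_3 flip: matrix_vector_mul_assoc)
  then have inv: "?A ** matrix_inv ?A = mat 1 \<and> matrix_inv ?A ** ?A = mat 1"
    unfolding matrix_inv_def by (rule someI)
  define x where "x = matrix_inv ?A *v \<gamma>"
  have "?A *v x = \<gamma>"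
    using inv by (simp add: x_def matrix_vector_mul_assoc)
  then have "\<gamma>$1 = I1 * x$1" "\<gamma>$2 = I2 * x$2" "\<gamma>$3 = I3 * x$3"
    by (auto simp: inertia_mult)
  then show ?thesis
    using assms by (simp add: vec_eq_iff forall_3 flip: x_def)
qed

lemma F_conf_eq:
  assumes "I1 > 0" "I2 > 0" "I3 > 0"
  shows "F_conf a b \<mu> I1 I2 I3 \<gamma> =
     (1 + b/a)\<^sup>2 * (half_grad_F (\<mu> * b\<^sup>2) I1 I2 I3 \<gamma> \<bullet> \<gamma> + (\<mu> * b\<^sup>2)\<^sup>2)"
  using assms
  by (simp add: F_conf_def matrix_inv_inertia half_grad_F_def inner_vec_def sum_3 field_simps)
     (simp add: algebra_simps power2_eq_square power4_eq_xxxx)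

lemma F_conf_pos:
  assumes "a > 0" "b \<noteq> 0" "b \<noteq> - a" "\<mu> > 0" "I1 > 0" "I2 > 0" "I3 > 0"
  shows "F_conf a b \<mu> I1 I2 I3 \<gamma> > 0"
proof -
  have "1 + b/a \<noteq> 0" using assms by (simp add: field_simps add_eq_0_iff)
  moreover have "half_grad_F (\<mu> * b\<^sup>2) I1 I2 I3 \<gamma> \<bullet> \<gamma> \<ge> 0"
    using assms by (simp add: half_grad_F_def inner_vec_def sum_3 mult.assoc add_nonneg_nonneg)
  moreover have "(\<mu> * b\<^sup>2)\<^sup>2 > 0" using assms by simp
  ultimately show ?thesis
    using assms by (simp add: F_conf_eq add_nonneg_pos)
qed

lemma has_derivative_F_conf:
  assumes "I1 > 0" "I2 > 0" "I3 > 0"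
  shows "(F_conf a b \<mu> I1 I2 I3 has_derivative
     (\<lambda>y. (2 * (1 + b/a)\<^sup>2) *\<^sub>R half_grad_F (\<mu> * b\<^sup>2) I1 I2 I3 \<gamma> \<bullet> y)) (at \<gamma>)"
proof -
  note [derivative_intros] = linear_imp_has_derivative[OF linear_half_grad_F]
  show ?thesis
    unfolding F_conf_eq[OF assms, abs_def]
    by (auto intro!: derivative_eq_intros simp: fun_eq_iff)
       (simp add: half_grad_F_def inner_vec_def sum_3 algebra_simps)
qed

text \<open>The Legendre transform is inverted explicitly on the one vector that matters. For \<open>N\<close> the half
  gradient, \<open>A (\<gamma> \<times> (\<gamma> \<times> N)) \<times> \<gamma>\<close> equals \<open>\<gamma> \<times> A N - (\<gamma>, N) \<gamma> \<times> A \<gamma>\<close> on the unit sphere, and the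
  theorem of Cayley and Hamilton expresses \<open>det A A\<^sup>-\<^sup>1\<close> by \<open>A\<^sup>2\<close>, \<open>A\<close> and the identity. The terms with
  \<open>\<gamma> \<times> A\<^sup>2 \<gamma>\<close> cancel, and the coefficient of \<open>\<gamma> \<times> A \<gamma>\<close> is \<open>- F\<close>.\<close>

lemma legendre_half_grad_F:
  assumes I: "I1 > 0" "I2 > 0" "I3 > 0" and \<gamma>: "norm \<gamma> = 1"
  shows "legendre a b \<mu> (inertia I1 I2 I3) \<gamma> (cross3 \<gamma> (half_grad_F (\<mu> * b\<^sup>2) I1 I2 I3 \<gamma>))
     = - F_conf a b \<mu> I1 I2 I3 \<gamma> *\<^sub>R cross3 \<gamma> (inertia I1 I2 I3 *v \<gamma>)"
proof -
  define m where "m = \<mu> * b\<^sup>2"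
  have "\<gamma> \<bullet> \<gamma> = 1" using \<gamma> by (simp add: dot_square_norm)
  then have 1: "(\<gamma>$1)\<^sup>2 = 1 - (\<gamma>$2)\<^sup>2 - (\<gamma>$3)\<^sup>2"
    by (simp add: inner_vec_def sum_3 power2_eq_square)
  have "m *\<^sub>R cross3 \<gamma> (half_grad_F m I1 I2 I3 \<gamma>)
        + cross3 (inertia I1 I2 I3 *v cross3 \<gamma> (cross3 \<gamma> (half_grad_F m I1 I2 I3 \<gamma>))) \<gamma>
     = - (half_grad_F m I1 I2 I3 \<gamma> \<bullet> \<gamma> + m\<^sup>2) *\<^sub>R cross3 \<gamma> (inertia I1 I2 I3 *v \<gamma>)"
    by (simp add: vec_eq_iff forall_3 inertia_mult half_grad_F_def cross3_def inner_vec_def sum_3)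
       (use 1 in \<open>intro conjI; algebra\<close>)
  then show ?thesis
    by (simp only: legendre_def F_conf_eq[OF I] m_def[symmetric] scaleR_scaleR mult_minus_right)
qed

definition gyroscopic_field :: "real \<Rightarrow> real \<Rightarrow> real \<Rightarrow> real \<Rightarrow> real \<Rightarrow> real \<Rightarrow> real^3 \<Rightarrow> real^3" where
  "gyroscopic_field a b \<mu> I1 I2 I3 \<gamma> =
     ((b/a - 1) * (1 + b/a)\<^sup>2 / F_conf a b \<mu> I1 I2 I3 \<gamma>) *\<^sub>R
       cross3 \<gamma> (half_grad_F (\<mu> * b\<^sup>2) I1 I2 I3 \<gamma>)"

text \<open>The pairing \<open>(J, K)\<close> contains \<open>(\<gamma>, A (v \<times> \<gamma>)) = (v, \<gamma> \<times> A \<gamma>)\<close> with \<open>G v = p\<close>. As \<open>G\<close> is symmetric, this is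
  \<open>(p, G\<^sup>-\<^sup>1 (\<gamma> \<times> A \<gamma>))\<close>, and the preceding identity gives \<open>G\<^sup>-\<^sup>1 (\<gamma> \<times> A \<gamma>) = - (\<gamma> \<times> N) / F\<close>. So \<open>(J, K)\<close> is
  linear in the momentum, with a coefficient that is smooth in \<open>\<gamma>\<close> and free of the inverse of \<open>G\<close>.\<close>

lemma JK_eq_gyroscopic_field:
  assumes pos: "a > 0" "b \<noteq> 0" "b \<noteq> - a" "\<mu> > 0" "I1 > 0" "I2 > 0" "I3 > 0"
    and x: "x \<in> cotangent_S2"
  shows "JK a b \<mu> (inertia I1 I2 I3) x X Y =
     (snd x \<bullet> gyroscopic_field a b \<mu> I1 I2 I3 (fst x)) * area_S2 (fst x) (fst X) (fst Y)"
proof -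
  obtain \<gamma> p where xp: "x = (\<gamma>, p)" by (cases x)
  have \<gamma>: "norm \<gamma> = 1" and p: "p \<in> sphere_tangent \<gamma>" using x by (auto simp: xp cotangent_S2_def)
  let ?A = "inertia I1 I2 I3" and ?N = "half_grad_F (\<mu> * b\<^sup>2) I1 I2 I3 \<gamma>"
    and ?F = "F_conf a b \<mu> I1 I2 I3 \<gamma>"
  let ?G = "legendre a b \<mu> ?A \<gamma>"
  define v where "v = legendre_inv a b \<mu> ?A \<gamma> p"
  have Gv: "?G v = p"
    using legendre_bij[OF pos, of \<gamma>] p unfolding v_def legendre_inv_def
    by (simp add: bij_betw_def f_inv_into_f)
  have sym: "?G u \<bullet> w = u \<bullet> ?G w" for u w
    by (simp add: legendre_def inertia_mult cross3_def inner_vec_def sum_3 algebra_simps)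
  have "p \<bullet> cross3 \<gamma> ?N = v \<bullet> ?G (cross3 \<gamma> ?N)"
    by (simp add: sym flip: Gv)
  also have "\<dots> = - ?F * (v \<bullet> cross3 \<gamma> (?A *v \<gamma>))"
    by (simp add: legendre_half_grad_F[OF pos(5-7) \<gamma>])
  also have "v \<bullet> cross3 \<gamma> (?A *v \<gamma>) = \<gamma> \<bullet> (?A *v cross3 v \<gamma>)"
    by (simp add: inertia_mult cross3_def inner_vec_def sum_3 algebra_simps)
  finally have "p \<bullet> cross3 \<gamma> ?N = - ?F * (\<gamma> \<bullet> (?A *v cross3 v \<gamma>))" .
  moreover have "?F > 0" using F_conf_pos[OF pos] .
  ultimately have "p \<bullet> gyroscopic_field a b \<mu> I1 I2 I3 \<gamma>
      = (1 - b/a) * (1 + b/a)\<^sup>2 * (\<gamma> \<bullet> (?A *v cross3 v \<gamma>))"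
    by (simp add: gyroscopic_field_def) (simp add: algebra_simps)
  then show ?thesis
    by (simp add: JK_def xp Let_def flip: v_def)
qed

theorem theorem4:
  fixes a b \<mu> I1 I2 I3 :: real
  assumes "a > 0" and "b \<noteq> 0" and "b \<noteq> - a" and "\<mu> > 0"
    and "I1 > 0" and "I2 > 0" and "I3 > 0"
  shows "conformally_symplectic_with cotangent_S2
           (omega_nh a b \<mu> (inertia I1 I2 I3))
           (\<lambda>x. f_conf a b \<mu> I1 I2 I3 (fst x))"
proof -
  let ?F = "F_conf a b \<mu> I1 I2 I3" and ?f = "f_conf a b \<mu> I1 I2 I3"
    and ?N = "half_grad_F (\<mu> * b\<^sup>2) I1 I2 I3" and ?\<xi> = "gyroscopic_field a b \<mu> I1 I2 I3"
    and ?\<omega> = "omega_nh a b \<mu> (inertia I1 I2 I3)"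
  \<comment> \<open>The gradient of \<open>f = F powr \<kappa>\<close>, namely \<open>2 \<kappa> f (1 + b/a)\<^sup>2 N / F\<close> with \<open>2 \<kappa> = b/a - 1\<close>.\<close>
  define g where "g \<gamma> = (?f \<gamma> * (b/a - 1) * (1 + b/a)\<^sup>2 / ?F \<gamma>) *\<^sub>R ?N \<gamma>" for \<gamma>
  have F: "?F \<gamma> > 0" for \<gamma> by (rule F_conf_pos[OF assms])
  have dF: "(?F has_derivative (\<lambda>y. (2 * (1 + b/a)\<^sup>2) *\<^sub>R ?N \<gamma> \<bullet> y)) (at \<gamma>)" for \<gamma>
    by (rule has_derivative_F_conf) (use assms in auto)
  have f: "(?f has_derivative (\<lambda>y. g \<gamma> \<bullet> y)) (at \<gamma>)" for \<gamma>
  proof -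
    define \<kappa> where "\<kappa> = (b - a) / (2 * a)"
    have "(?f has_derivative (\<lambda>y. ?F \<gamma> powr \<kappa> *
        (0 * ln (?F \<gamma>) + (2 * (1 + b/a)\<^sup>2) *\<^sub>R ?N \<gamma> \<bullet> y * \<kappa> / ?F \<gamma>))) (at \<gamma>)"
      unfolding f_conf_def[abs_def] \<kappa>_def[symmetric]
      by (rule has_derivative_powr[OF dF has_derivative_const F]) auto
    moreover have "b/a - 1 = 2 * \<kappa>" using assms by (simp add: \<kappa>_def field_simps)
    moreover have "?f \<gamma> = ?F \<gamma> powr \<kappa>" by (simp add: f_conf_def \<kappa>_def)
    ultimately show ?thesis
      by (simp add: g_def mult_ac)
  qed
  have \<xi>: "?\<xi> differentiable (at \<gamma>)" for \<gamma>
  proof -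
    have "((\<lambda>\<gamma>. cross3 \<gamma> (?N \<gamma>)) has_derivative (\<lambda>y. cross3 \<gamma> (?N y) + cross3 y (?N \<gamma>))) (at \<gamma>)"
      using bilinear_cross
      by (intro bounded_bilinear.FDERIV has_derivative_ident linear_imp_has_derivative linear_half_grad_F)
         (simp_all add: bilinear_conv_bounded_bilinear)
    moreover have "?F differentiable (at \<gamma>)"
      using dF by (auto simp: differentiable_def)
    ultimately show ?thesis
      unfolding gyroscopic_field_def[abs_def] using F[of \<gamma>]
      by (intro differentiable_scaleR differentiable_divide differentiable_const)
         (auto simp: differentiable_def)
  qed
  have eq: "?f \<gamma> *\<^sub>R ?\<xi> \<gamma> = cross3 \<gamma> (g \<gamma>)" for \<gamma>
    by (simp add: gyroscopic_field_def g_def cross_mult_right)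
  have \<omega>: "?\<omega> x X Y = omega_can x X Y + (snd x \<bullet> ?\<xi> (fst x)) * area_S2 (fst x) (fst X) (fst Y)"
    if "x \<in> cotangent_S2" for x X Y
    by (simp add: omega_nh_def JK_eq_gyroscopic_field[OF assms that])
  have "has_exterior_derivative_on (\<lambda>x X Y. ?f (fst x) * ?\<omega> x X Y) (\<lambda>_ _ _ _. 0) cotangent_S2"
    by (rule has_exterior_derivative_on_cong[OF _ gyroscopic_form_closed[OF f \<xi> eq]])
       (simp add: gyroscopic_form_def \<omega>)
  moreover have "nondegenerate_on ?\<omega> cotangent_S2"
    by (rule nondegenerate_omega_can_plus_semibasic[OF \<omega>])
  moreover have "?f \<gamma> > 0" for \<gamma> using F[of \<gamma>] by (simp add: f_conf_def)
  ultimately show ?thesis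
    by (simp add: conformally_symplectic_with_def)
qed

end
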